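(* Let $\mathbf{K}$ be a finitely generated field over an algebraically closed characteristic zero field $\mathbf{k}$, and let $X$ be a normal proper model of $\mathbf{K}$. Fix two finite dimensional $\mathbf{K}$-central simple algebras $\Sigma_1$ and $\Sigma_2$ with an $X$-effective embedding $\Sigma_1\hookrightarrow\Sigma_2$ of $\mathbf{K}$-algebras. Let $\alpha_1,\alpha_2\in\operatorname{Br}(\mathbf{K})$ be the Brauer classes of $\Sigma_1,\Sigma_2$, let $\Delta_{\alpha_1},\Delta_{\alpha_2}$ be the Weil divisors on $X$ determined by the ramification of $\alpha_1,\alpha_2$, fix a canonical divisor $K_X$ on $X$, and put $K_{\alpha_i}:=K_X+\Delta_{\alpha_i}$ for $i=1,2$. Then: (1) $\Delta_{\alpha_1}\le\Delta_{\alpha_2}$. (2) If $\Sigma_1\mid_X\Sigma_2$, then $$K_{\alpha_2}=K_{\alpha_1}+\sum_{\mathfrak p}\frac{1}{e_{\mathfrak p}(\alpha_1)}\left(1-\frac{1}{e_{\alpha_2/\alpha_1}(\mathfrak p)}\right)\mathfrak p,$$ the sum being over prime divisors $\mathfrak p$ of $X$, where $e_{\alpha_2/\alpha_1}(\mathfrak p):=e_{\mathfrak p}(\alpha_2)/e_{\mathfrak p}(\alpha_1)$. (3) If the log canonical divisors $K_{\alpha_i}$, $i=1,2$, are $\mathbb{Q}$-Cartier and $\Sigma_1\le_X\Sigma_2$, then $$\kappa(X,\alpha_1)\le\kappa(X,\alpha_2).$$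
   Context: A normal proper model of $\mathbf{K}$ is a normal integral proper variety over $\mathbf{k}$ with function field $\mathbf{K}$. For $\alpha\in\operatorname{Br}(\mathbf{K})$ and a prime divisor $\mathfrak p$ on $X$, let $\mathbf{K}_{\mathfrak p}$ be the completion of $\mathbf{K}$ at $\mathfrak p$, $\mathfrak{D}_{\mathfrak p}$ the $\mathbf{K}_{\mathfrak p}$-central division algebra with the class of $\alpha\otimes\mathbf{K}_{\mathfrak p}$, and $\mathfrak R$ its unique maximal $\hat{\mathcal{O}}_{X,\mathfrak p}$-order. The ramification index $e_{\mathfrak p}(\alpha)$ is defined by $(\operatorname{rad}\mathfrak R)^{e_{\mathfrak p}(\alpha)}=\hat{\mathfrak m}_{\mathfrak p}\mathfrak R$. The ramification divisor of $\alpha$ on $X$ is $\Delta_\alpha=\sum_{\mathfrak p}(1-1/e_{\mathfrak p}(\alpha))\mathfrak p$. $\Sigma_1\le_X\Sigma_2$ (the embedding is $X$-effective) means that $\Delta_{\alpha_2}-\Delta_{\alpha_1}\ge0$ on $X$. $\Sigma_1\mid_X\Sigma_2$ means that $e_{\mathfrak p}(\alpha_1)$ divides $e_{\mathfrak p}(\alpha_2)$ for every prime divisor $\mathfrak p$ of $X$. $\kappa(X,\alpha):=\kappa(X,K_X+\Delta_\alpha)$, where $\kappa(X,D)$ is $-1$ if $\mathrm{H}^0(X,\mathcal{O}_X(\lfloor\ell D\rfloor))=0$ for all $\ell>0$, and otherwise the transcendence degree over $\mathbf{k}$ of the field of degree zero homogeneous fractions of $\bigoplus_{\ell\ge0}\mathrm{H}^0(X,\mathcal{O}_X(\lfloor\ell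 D\rfloor))$. *)

theory Defs
  imports
    "HOL-Algebra.Algebra"
    "HOL-Library.Extended_Real"
    "HOL-Library.Function_Algebras"
begin

section \<open>Rings by generators and relations\<close>

definition msingle :: "'g \<Rightarrow> 'g \<Rightarrow> int"
  where "msingle g = (\<lambda>x. if x = g then 1 else 0)"

text \<open>The integral monoid ring \<open>\<int>[M]\<close>, with finitely supported functions as elements.\<close>

definition monoid_ring :: "('g, 'm) monoid_scheme \<Rightarrow> ('g \<Rightarrow> int) ring"
  where "monoid_ring M =
    \<lparr> carrier = {f. finite {x. f x \<noteq> 0} \<and> {x. f x \<noteq> 0} \<subseteq> carrier M},
      monoid.mult = (\<lambda>f g z. \<Sum>(x, y) \<in> {(x, y). f x \<noteq> 0 \<and> g y \<noteq> 0 \<and> x \<otimes>\<^bsub>M\<^esub> y = z}. f x * g y),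
      one = msingle \<one>\<^bsub>M\<^esub>,
      ring.zero = (\<lambda>_. 0),
      add = (\<lambda>f g x. f x + g x) \<rparr>"


section \<open>Algebras over a field and Brauer classes\<close>

text \<open>
  An algebra over a field \<open>F\<close> is given by a unital ring \<open>A\<close> (not assumed commutative) and a
  structure map \<open>i\<close> from \<open>F\<close> to the centre of \<open>A\<close>.
\<close>

definition algebra_over ::
    "('a, 'm) ring_scheme \<Rightarrow> ('b, 'n) ring_scheme \<Rightarrow> ('a \<Rightarrow> 'b) \<Rightarrow> bool"
  where "algebra_over F A i \<longleftrightarrow> ring A \<and> i \<in> ring_hom F A \<and>
    (\<forall>c \<in> carrier F. \<forall>x \<in> carrier A. i c \<otimes>\<^bsub>A\<^esub> x = x \<otimes>\<^bsub>A\<^esub> i c)"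

definition ring_center :: "('b, 'n) ring_scheme \<Rightarrow> 'b set"
  where "ring_center A = {z \<in> carrier A. \<forall>x \<in> carrier A. z \<otimes>\<^bsub>A\<^esub> x = x \<otimes>\<^bsub>A\<^esub> z}"

definition csa :: "('a, 'm) ring_scheme \<Rightarrow> ('b, 'n) ring_scheme \<Rightarrow> ('a \<Rightarrow> 'b) \<Rightarrow> bool"
  where "csa F A i \<longleftrightarrow> algebra_over F A i \<and>
    ring.finite_dimension A (i ` carrier F) (carrier A) \<and>
    ring_center A = i ` carrier F \<and>
    \<one>\<^bsub>A\<^esub> \<noteq> \<zero>\<^bsub>A\<^esub> \<and>
    (\<forall>I. ideal I A \<longrightarrow> I = {\<zero>\<^bsub>A\<^esub>} \<or> I = carrier A)"

definition algebra_embedding ::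
    "('a, 'm) ring_scheme \<Rightarrow> ('b, 'n) ring_scheme \<Rightarrow> ('a \<Rightarrow> 'b) \<Rightarrow>
     ('c, 'o) ring_scheme \<Rightarrow> ('a \<Rightarrow> 'c) \<Rightarrow> ('b \<Rightarrow> 'c) \<Rightarrow> bool"
  where "algebra_embedding F A i B j \<phi> \<longleftrightarrow>
    \<phi> \<in> ring_hom A B \<and> inj_on \<phi> (carrier A) \<and> (\<forall>c \<in> carrier F. \<phi> (i c) = j c)"

definition matrix_ring :: "nat \<Rightarrow> ('b, 'n) ring_scheme \<Rightarrow> (nat \<Rightarrow> nat \<Rightarrow> 'b) ring"
  where "matrix_ring n A =
    \<lparr> carrier = {M. \<forall>r s. if r < n \<and> s < n then M r s \<in> carrier A else M r s = \<zero>\<^bsub>A\<^esub>},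
      monoid.mult = (\<lambda>M N r s. if r < n \<and> s < n
                then finsum A (\<lambda>t. M r t \<otimes>\<^bsub>A\<^esub> N t s) {..<n} else \<zero>\<^bsub>A\<^esub>),
      one = (\<lambda>r s. if r < n \<and> r = s then \<one>\<^bsub>A\<^esub> else \<zero>\<^bsub>A\<^esub>),
      ring.zero = (\<lambda>r s. \<zero>\<^bsub>A\<^esub>),
      add = (\<lambda>M N r s. if r < n \<and> s < n then M r s \<oplus>\<^bsub>A\<^esub> N r s else \<zero>\<^bsub>A\<^esub>) \<rparr>"

definition scalar_matrix ::
    "nat \<Rightarrow> ('b, 'n) ring_scheme \<Rightarrow> 'b \<Rightarrow> nat \<Rightarrow> nat \<Rightarrow> 'b"
  where "scalar_matrix n A a = (\<lambda>r s. if r < n \<and> r = s then a else \<zero>\<^bsub>A\<^esub>)"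

definition brauer_equiv ::
    "('a, 'm) ring_scheme \<Rightarrow> ('b, 'n) ring_scheme \<Rightarrow> ('a \<Rightarrow> 'b) \<Rightarrow>
     ('c, 'o) ring_scheme \<Rightarrow> ('a \<Rightarrow> 'c) \<Rightarrow> bool"
  where "brauer_equiv F A i B j \<longleftrightarrow>
    (\<exists>m > 0. \<exists>n > 0. \<exists>\<phi> \<in> ring_iso (matrix_ring m A) (matrix_ring n B).
       \<forall>c \<in> carrier F. \<phi> (scalar_matrix m A (i c)) = scalar_matrix n B (j c))"

text \<open>
  A Brauer class over \<open>F\<close> is a set of central simple algebras whose elements have type
  \<open>nat \<Rightarrow> 'a\<close>. Every finite dimensional \<open>F\<close>-algebra has an isomorphic copy of that type
  (coordinate vectors in a basis), so no Brauer class is lost by fixing it.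
\<close>

type_synonym 'a brauer = "((nat \<Rightarrow> 'a) ring \<times> ('a \<Rightarrow> nat \<Rightarrow> 'a)) set"

definition brauer_class ::
    "('a, 'm) ring_scheme \<Rightarrow> ('b, 'n) ring_scheme \<Rightarrow> ('a \<Rightarrow> 'b) \<Rightarrow> 'a brauer"
  where "brauer_class F A i = {(B, j). csa F B j \<and> brauer_equiv F A i B j}"

text \<open>
  The tensor product \<open>A \<otimes>\<^sub>F L\<close> of an \<open>F\<close>-algebra \<open>(A, i)\<close> with a commutative \<open>F\<close>-algebra
  \<open>(L, h)\<close>, presented as \<open>\<int>[A \<times> L]\<close> modulo the bilinearity relations.
  The image of \<open>(x, c)\<close> is the pure tensor \<open>x \<otimes> c\<close>.
\<close>

definition tensor_relations ::
    "('a, 'm) ring_scheme \<Rightarrow> ('b, 'n) ring_scheme \<Rightarrow> ('a \<Rightarrow> 'b) \<Rightarrow>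
     ('l, 'o) ring_scheme \<Rightarrow> ('a \<Rightarrow> 'l) \<Rightarrow> ('b \<times> 'l \<Rightarrow> int) set"
  where "tensor_relations F A i L h =
    {msingle (x \<oplus>\<^bsub>A\<^esub> y, c) - msingle (x, c) - msingle (y, c) | x y c.
        x \<in> carrier A \<and> y \<in> carrier A \<and> c \<in> carrier L} \<union>
    {msingle (x, c \<oplus>\<^bsub>L\<^esub> d) - msingle (x, c) - msingle (x, d) | x c d.
        x \<in> carrier A \<and> c \<in> carrier L \<and> d \<in> carrier L} \<union>
    {msingle (i a \<otimes>\<^bsub>A\<^esub> x, c) - msingle (x, h a \<otimes>\<^bsub>L\<^esub> c) | a x c.
        a \<in> carrier F \<and> x \<in> carrier A \<and> c \<in> carrier L}"

definition tensor_ideal ::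
    "('a, 'm) ring_scheme \<Rightarrow> ('b, 'n) ring_scheme \<Rightarrow> ('a \<Rightarrow> 'b) \<Rightarrow>
     ('l, 'o) ring_scheme \<Rightarrow> ('a \<Rightarrow> 'l) \<Rightarrow> ('b \<times> 'l \<Rightarrow> int) set"
  where "tensor_ideal F A i L h = Idl\<^bsub>monoid_ring (A \<times>\<times> L)\<^esub> (tensor_relations F A i L h)"

definition base_change ::
    "('a, 'm) ring_scheme \<Rightarrow> ('b, 'n) ring_scheme \<Rightarrow> ('a \<Rightarrow> 'b) \<Rightarrow>
     ('l, 'o) ring_scheme \<Rightarrow> ('a \<Rightarrow> 'l) \<Rightarrow> ('b \<times> 'l \<Rightarrow> int) set ring"
  where "base_change F A i L h = monoid_ring (A \<times>\<times> L) Quot tensor_ideal F A i L h"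

definition base_change_scalar ::
    "('a, 'm) ring_scheme \<Rightarrow> ('b, 'n) ring_scheme \<Rightarrow> ('a \<Rightarrow> 'b) \<Rightarrow>
     ('l, 'o) ring_scheme \<Rightarrow> ('a \<Rightarrow> 'l) \<Rightarrow> 'l \<Rightarrow> ('b \<times> 'l \<Rightarrow> int) set"
  where "base_change_scalar F A i L h c =
    tensor_ideal F A i L h +>\<^bsub>monoid_ring (A \<times>\<times> L)\<^esub> msingle (\<one>\<^bsub>A\<^esub>, c)"

text \<open>The class \<open>\<alpha> \<otimes> L\<close> in the Brauer group of \<open>L\<close>.\<close>

definition brauer_base_change ::
    "('a, 'm) ring_scheme \<Rightarrow> ('l, 'o) ring_scheme \<Rightarrow> ('a \<Rightarrow> 'l) \<Rightarrow> 'a brauer \<Rightarrow> 'l brauer"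
  where "brauer_base_change F L h \<alpha> =
    (\<Union>(A, i) \<in> \<alpha>. brauer_class L (base_change F A i L h) (base_change_scalar F A i L h))"


section \<open>Transcendence degree\<close>

text \<open>
  Exponent vectors are functions \<open>e :: 'a \<Rightarrow> nat\<close> vanishing off \<open>S\<close>; the sum below is the value at
  \<open>S\<close> of the polynomial with coefficients \<open>c\<close>.
\<close>

definition algebraically_independent :: "('a, 'm) ring_scheme \<Rightarrow> 'a set \<Rightarrow> 'a set \<Rightarrow> bool"
  where "algebraically_independent K k S \<longleftrightarrow>
    (\<forall>E c. finite E \<and> (\<forall>e \<in> E. \<forall>x. x \<notin> S \<longrightarrow> e x = (0::nat)) \<and> (\<forall>e \<in> E. c e \<in> k) \<and>
       finsum K (\<lambda>e. c e \<otimes>\<^bsub>K\<^esub> finprod K (\<lambda>x. x [^]\<^bsub>K\<^esub> e x) S) E = \<zero>\<^bsub>K\<^esub>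
       \<longrightarrow> (\<forall>e \<in> E. c e = \<zero>\<^bsub>K\<^esub>))"

definition trdeg :: "('a, 'm) ring_scheme \<Rightarrow> 'a set \<Rightarrow> 'a set \<Rightarrow> enat"
  where "trdeg K k L =
    Sup {enat (card S) | S. finite S \<and> S \<subseteq> L \<and> algebraically_independent K k S}"


section \<open>Normal proper models\<close>

text \<open>
  A variety with function field \<open>K\<close> is represented, following Zariski, as the set of the local rings
  (subrings of \<open>K\<close>) of its scheme points. The local rings of an affine variety are the localizations
  of its coordinate ring at all prime ideals.
\<close>

definition localization :: "('a, 'm) ring_scheme \<Rightarrow> 'a set \<Rightarrow> 'a set \<Rightarrow> 'a set"
  where "localization K A P = {a \<otimes>\<^bsub>K\<^esub> inv\<^bsub>K\<^esub> s | a s. a \<in> A \<and> s \<in> A - P}"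

definition affine_coordinate_ring :: "('a, 'm) ring_scheme \<Rightarrow> 'a set \<Rightarrow> 'a set \<Rightarrow> bool"
  where "affine_coordinate_ring K k A \<longleftrightarrow>
    (\<exists>S. finite S \<and> S \<subseteq> carrier K \<and> A = generate_ring K (k \<union> S)) \<and>
    generate_field K A = carrier K"

definition affine_model :: "('a, 'm) ring_scheme \<Rightarrow> 'a set \<Rightarrow> 'a set set"
  where "affine_model K A = {localization K A P | P. primeideal P (K\<lparr>carrier := A\<rparr>)}"

text \<open>The maximal ideal of a local ring.\<close>

definition max_ideal :: "('a, 'm) ring_scheme \<Rightarrow> 'a set \<Rightarrow> 'a set"
  where "max_ideal K R = R - Units (K\<lparr>carrier := R\<rparr>)"

definition valuation_ring :: "('a, 'm) ring_scheme \<Rightarrow> 'a set \<Rightarrow> 'a set \<Rightarrow> bool"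
  where "valuation_ring K k V \<longleftrightarrow> subring V K \<and> k \<subseteq> V \<and>
    (\<forall>x \<in> carrier K - {\<zero>\<^bsub>K\<^esub>}. x \<in> V \<or> inv\<^bsub>K\<^esub> x \<in> V)"

definition dominates :: "('a, 'm) ring_scheme \<Rightarrow> 'a set \<Rightarrow> 'a set \<Rightarrow> bool"
  where "dominates K V R \<longleftrightarrow> R \<subseteq> V \<and> max_ideal K R = max_ideal K V \<inter> R"

text \<open>Polynomials are coefficient lists with the leading coefficient first.\<close>

definition integrally_closed :: "('a, 'm) ring_scheme \<Rightarrow> 'a set \<Rightarrow> bool"
  where "integrally_closed K R \<longleftrightarrow>
    (\<forall>x \<in> carrier K. \<forall>p. p \<noteq> [] \<and> hd p = \<one>\<^bsub>K\<^esub> \<and> set p \<subseteq> R \<and> ring.eval K p x = \<zero>\<^bsub>K\<^esub> \<longrightarrow> x \<in> R)"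

text \<open>
  A finite union of affine models is separated iff every valuation ring of \<open>K\<close> over \<open>k\<close>
  dominates at most one of its local rings, and proper iff it dominates exactly one.
\<close>

definition normal_proper_model :: "('a, 'm) ring_scheme \<Rightarrow> 'a set \<Rightarrow> 'a set set \<Rightarrow> bool"
  where "normal_proper_model K k Y \<longleftrightarrow>
    (\<exists>\<C>. finite \<C> \<and> (\<forall>A \<in> \<C>. affine_coordinate_ring K k A) \<and>
          Y = \<Union>(affine_model K ` \<C>)) \<and>
    (\<forall>V. valuation_ring K k V \<longrightarrow> (\<exists>!R. R \<in> Y \<and> dominates K V R)) \<and>
    (\<forall>R \<in> Y. integrally_closed K R)"

text \<open>
  The Zariski topology on a model is generated by the domains of definition
  \<open>{R \<in> Y. f \<in> R}\<close> of the rational functions \<open>f\<close>.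
\<close>

definition zariski_open :: "('a, 'm) ring_scheme \<Rightarrow> 'a set set \<Rightarrow> 'a set set \<Rightarrow> bool"
  where "zariski_open K Y U \<longleftrightarrow> U \<subseteq> Y \<and>
    generate_topology {{R \<in> Y. f \<in> R} | f. f \<in> carrier K} U"


section \<open>Weil divisors\<close>

text \<open>
  Prime divisors are identified with their generic points, the points whose local ring has Krull
  dimension one. A \<open>\<rat>\<close>-divisor is its coefficient function, which is \<open>0\<close> off the prime divisors;
  sums, differences and the order of divisors are the pointwise ones.
\<close>

definition prime_divisors :: "('a, 'm) ring_scheme \<Rightarrow> 'a set set \<Rightarrow> 'a set set"
  where "prime_divisors K Y = {R \<in> Y. R \<noteq> carrier K \<and>
    (\<forall>P. primeideal P (K\<lparr>carrier := R\<rparr>) \<longrightarrow> P = {\<zero>\<^bsub>K\<^esub>} \<or> P = max_ideal K R)}"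

type_synonym 'a qdivisor = "'a set \<Rightarrow> rat"

definition formal_sum ::
    "('a, 'm) ring_scheme \<Rightarrow> 'a set set \<Rightarrow> ('a set \<Rightarrow> rat) \<Rightarrow> 'a qdivisor"
  where "formal_sum K Y c = (\<lambda>p. if p \<in> prime_divisors K Y then c p else 0)"

text \<open>The order of \<open>f \<noteq> 0\<close> with respect to a discrete valuation ring \<open>R\<close> of \<open>K\<close>.\<close>

definition val_ord :: "('a, 'm) ring_scheme \<Rightarrow> 'a set \<Rightarrow> 'a \<Rightarrow> int"
  where "val_ord K R f = (THE n. \<exists>t \<in> R. \<exists>u \<in> Units (K\<lparr>carrier := R\<rparr>).
    max_ideal K R = PIdl\<^bsub>K\<lparr>carrier := R\<rparr>\<^esub> t \<and> f = u \<otimes>\<^bsub>K\<^esub> (t [^]\<^bsub>K\<^esub> (n::int)))"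

definition cartier :: "('a, 'm) ring_scheme \<Rightarrow> 'a set set \<Rightarrow> 'a qdivisor \<Rightarrow> bool"
  where "cartier K Y D \<longleftrightarrow>
    (\<forall>x \<in> Y. \<exists>U. zariski_open K Y U \<and> x \<in> U \<and>
       (\<exists>f \<in> carrier K - {\<zero>\<^bsub>K\<^esub>}. \<forall>p \<in> prime_divisors K Y \<inter> U. D p = of_int (val_ord K p f)))"

definition q_cartier :: "('a, 'm) ring_scheme \<Rightarrow> 'a set set \<Rightarrow> 'a qdivisor \<Rightarrow> bool"
  where "q_cartier K Y D \<longleftrightarrow> (\<exists>m::nat. m > 0 \<and> cartier K Y (\<lambda>p. of_nat m * D p))"

text \<open>\<open>H\<^sup>0(Y, \<O>\<^sub>Y(\<lfloor>l D\<rfloor>))\<close>\<close>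

definition H0 :: "('a, 'm) ring_scheme \<Rightarrow> 'a set set \<Rightarrow> 'a qdivisor \<Rightarrow> nat \<Rightarrow> 'a set"
  where "H0 K Y D l = {f \<in> carrier K. f = \<zero>\<^bsub>K\<^esub> \<or>
    (\<forall>p \<in> prime_divisors K Y. val_ord K p f + \<lfloor>of_nat l * D p\<rfloor> \<ge> 0)}"

definition section_fractions :: "('a, 'm) ring_scheme \<Rightarrow> 'a set set \<Rightarrow> 'a qdivisor \<Rightarrow> 'a set"
  where "section_fractions K Y D =
    {a \<otimes>\<^bsub>K\<^esub> inv\<^bsub>K\<^esub> b | a b. \<exists>l. a \<in> H0 K Y D l \<and> b \<in> H0 K Y D l - {\<zero>\<^bsub>K\<^esub>}}"

definition kodaira :: "('a, 'm) ring_scheme \<Rightarrow> 'a set \<Rightarrow> 'a set set \<Rightarrow> 'a qdivisor \<Rightarrow> ereal"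
  where "kodaira K k Y D =
    (if \<forall>l > 0. H0 K Y D l = {\<zero>\<^bsub>K\<^esub>} then -1
     else ereal_of_enat (trdeg K k (section_fractions K Y D)))"


section \<open>Canonical divisors\<close>

text \<open>
  The exterior algebra of the Kaehler differentials of \<open>K\<close> over \<open>k\<close>, presented as the ring generated
  by symbols \<open>Fn a\<close> (the function \<open>a\<close>) and \<open>Dif a\<close> (the differential \<open>da\<close>).
\<close>

datatype 'a form_symbol = Fn 'a | Dif 'a

definition form_words :: "('a, 'm) ring_scheme \<Rightarrow> 'a form_symbol list monoid"
  where "form_words K =
    \<lparr> carrier = lists (Fn ` carrier K \<union> Dif ` carrier K), monoid.mult = (@), one = [] \<rparr>"

definition form_relations ::
    "('a, 'm) ring_scheme \<Rightarrow> 'a set \<Rightarrow> ('a form_symbol list \<Rightarrow> int) set"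
  where "form_relations K k =
    (\<Union>a \<in> carrier K. \<Union>b \<in> carrier K.
      { msingle [Fn (a \<oplus>\<^bsub>K\<^esub> b)] - msingle [Fn a] - msingle [Fn b],
        msingle [Fn (a \<otimes>\<^bsub>K\<^esub> b)] - msingle [Fn a, Fn b],
        msingle [Dif (a \<oplus>\<^bsub>K\<^esub> b)] - msingle [Dif a] - msingle [Dif b],
        msingle [Dif (a \<otimes>\<^bsub>K\<^esub> b)] - msingle [Fn a, Dif b] - msingle [Fn b, Dif a],
        msingle [Fn a, Dif b] - msingle [Dif b, Fn a],
        msingle [Dif a, Dif a] }) \<union>
    {msingle [Fn \<one>\<^bsub>K\<^esub>] - msingle []} \<union> {msingle [Dif c] | c. c \<in> k}"

definition form_ideal :: "('a, 'm) ring_scheme \<Rightarrow> 'a set \<Rightarrow> ('a form_symbol list \<Rightarrow> int) set"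
  where "form_ideal K k = Idl\<^bsub>monoid_ring (form_words K)\<^esub> (form_relations K k)"

definition form_algebra ::
    "('a, 'm) ring_scheme \<Rightarrow> 'a set \<Rightarrow> ('a form_symbol list \<Rightarrow> int) set ring"
  where "form_algebra K k = monoid_ring (form_words K) Quot form_ideal K k"

text \<open>The form \<open>f dx\<^sub>1 \<and> \<dots> \<and> dx\<^sub>n\<close>; for \<open>n = 0\<close> it is the function \<open>f\<close>.\<close>

definition diff_form ::
    "('a, 'm) ring_scheme \<Rightarrow> 'a set \<Rightarrow> 'a \<Rightarrow> 'a list \<Rightarrow> ('a form_symbol list \<Rightarrow> int) set"
  where "diff_form K k f xs =
    form_ideal K k +>\<^bsub>monoid_ring (form_words K)\<^esub> msingle (Fn f # map Dif xs)"

text \<open>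
  With \<open>n\<close> the transcendence degree, the image of the top forms of \<open>R\<close> in those of \<open>K\<close>. In the two
  uses below, \<open>R = K\<close> and \<open>R\<close> the local ring of a prime divisor, the differentials of \<open>R\<close> are free
  with a basis \<open>dt\<^sub>1, \<dots>, dt\<^sub>n\<close>, so that every top form is a single term \<open>f dt\<^sub>1 \<and> \<dots> \<and> dt\<^sub>n\<close>
  and no sums are needed.
\<close>

definition top_forms ::
    "('a, 'm) ring_scheme \<Rightarrow> 'a set \<Rightarrow> 'a set \<Rightarrow> ('a form_symbol list \<Rightarrow> int) set set"
  where "top_forms K k R = {diff_form K k f xs | f xs.
    f \<in> R \<and> set xs \<subseteq> R \<and> enat (length xs) = trdeg K k (carrier K)}"

text \<open>
  The order of a rational top form \<open>\<omega>\<close> along a prime divisor with local ring \<open>R\<close>: if \<open>\<eta>\<close> is a local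
  generator and \<open>\<omega> = g \<eta>\<close>, it is the order of \<open>g\<close>.
\<close>

definition form_ord ::
    "('a, 'm) ring_scheme \<Rightarrow> 'a set \<Rightarrow> 'a set \<Rightarrow> ('a form_symbol list \<Rightarrow> int) set \<Rightarrow> int"
  where "form_ord K k R \<omega> = (THE n. \<exists>\<eta> \<in> top_forms K k R. \<exists>g \<in> carrier K - {\<zero>\<^bsub>K\<^esub>}.
    top_forms K k R = {diff_form K k a [] \<otimes>\<^bsub>form_algebra K k\<^esub> \<eta> | a. a \<in> R} \<and>
    \<omega> = diff_form K k g [] \<otimes>\<^bsub>form_algebra K k\<^esub> \<eta> \<and>
    n = val_ord K R g)"

definition canonical_divisor ::
    "('a, 'm) ring_scheme \<Rightarrow> 'a set \<Rightarrow> 'a set set \<Rightarrow> 'a qdivisor \<Rightarrow> bool"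
  where "canonical_divisor K k Y D \<longleftrightarrow>
    (\<exists>\<omega> \<in> top_forms K k (carrier K). \<omega> \<noteq> \<zero>\<^bsub>form_algebra K k\<^esub> \<and>
       D = formal_sum K Y (\<lambda>p. of_int (form_ord K k p \<omega>)))"


section \<open>Completion at a prime divisor\<close>

primrec ideal_power :: "('a, 'm) ring_scheme \<Rightarrow> 'a set \<Rightarrow> nat \<Rightarrow> 'a set"
  where
    "ideal_power R I 0 = carrier R"
  | "ideal_power R I (Suc n) = ideal_prod R I (ideal_power R I n)"

definition max_power :: "('a, 'm) ring_scheme \<Rightarrow> 'a set \<Rightarrow> nat \<Rightarrow> 'a set"
  where "max_power K R n = ideal_power (K\<lparr>carrier := R\<rparr>) (max_ideal K R) n"

definition cauchy_ring :: "('a, 'm) ring_scheme \<Rightarrow> 'a set \<Rightarrow> (nat \<Rightarrow> 'a) ring"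
  where "cauchy_ring K R =
    \<lparr> carrier = {s. range s \<subseteq> carrier K \<and>
        (\<forall>n. \<exists>N. \<forall>i \<ge> N. \<forall>j \<ge> N. s i \<ominus>\<^bsub>K\<^esub> s j \<in> max_power K R n)},
      monoid.mult = (\<lambda>s t i. s i \<otimes>\<^bsub>K\<^esub> t i),
      one = (\<lambda>i. \<one>\<^bsub>K\<^esub>),
      ring.zero = (\<lambda>i. \<zero>\<^bsub>K\<^esub>),
      add = (\<lambda>s t i. s i \<oplus>\<^bsub>K\<^esub> t i) \<rparr>"

definition null_sequences :: "('a, 'm) ring_scheme \<Rightarrow> 'a set \<Rightarrow> (nat \<Rightarrow> 'a) set"
  where "null_sequences K R =
    {s. range s \<subseteq> carrier K \<and> (\<forall>n. \<exists>N. \<forall>i \<ge> N. s i \<in> max_power K R n)}"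

definition completion :: "('a, 'm) ring_scheme \<Rightarrow> 'a set \<Rightarrow> (nat \<Rightarrow> 'a) set ring"
  where "completion K R = cauchy_ring K R Quot null_sequences K R"

definition to_completion :: "('a, 'm) ring_scheme \<Rightarrow> 'a set \<Rightarrow> 'a \<Rightarrow> (nat \<Rightarrow> 'a) set"
  where "to_completion K R x = null_sequences K R +>\<^bsub>cauchy_ring K R\<^esub> (\<lambda>_. x)"

text \<open>
  The closure of \<open>S\<close> in the completion. For \<open>S = R\<close> it is the completion of \<open>R\<close>, and for \<open>S\<close> the
  maximal ideal of \<open>R\<close> it is the maximal ideal of the completion of \<open>R\<close>.
\<close>

definition completed :: "('a, 'm) ring_scheme \<Rightarrow> 'a set \<Rightarrow> 'a set \<Rightarrow> (nat \<Rightarrow> 'a) set set"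
  where "completed K R S = {null_sequences K R +>\<^bsub>cauchy_ring K R\<^esub> s | s.
    s \<in> carrier (cauchy_ring K R) \<and> range s \<subseteq> S}"


section \<open>Ramification\<close>

definition division_ring :: "('b, 'n) ring_scheme \<Rightarrow> bool"
  where "division_ring D \<longleftrightarrow>
    ring D \<and> \<one>\<^bsub>D\<^esub> \<noteq> \<zero>\<^bsub>D\<^esub> \<and> Units D = carrier D - {\<zero>\<^bsub>D\<^esub>}"

text \<open>
  \<open>\<Lambda>\<close> is an \<open>B\<close>-order in the \<open>F\<close>-algebra \<open>(D, j)\<close>, where \<open>B\<close> is a subring of \<open>F\<close>: a subring of \<open>D\<close>
  that contains \<open>B\<close>, is a finitely generated \<open>B\<close>-module, and spans \<open>D\<close> over \<open>F\<close>.
\<close>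

definition is_order ::
    "('a, 'm) ring_scheme \<Rightarrow> 'a set \<Rightarrow> ('b, 'n) ring_scheme \<Rightarrow> ('a \<Rightarrow> 'b) \<Rightarrow> 'b set \<Rightarrow> bool"
  where "is_order F B D j \<Lambda> \<longleftrightarrow> subring \<Lambda> D \<and> j ` B \<subseteq> \<Lambda> \<and>
    (\<exists>us. set us \<subseteq> \<Lambda> \<and> \<Lambda> = ring.Span D (j ` B) us) \<and>
    ideal_prod D (j ` carrier F) \<Lambda> = carrier D"

definition is_maximal_order ::
    "('a, 'm) ring_scheme \<Rightarrow> 'a set \<Rightarrow> ('b, 'n) ring_scheme \<Rightarrow> ('a \<Rightarrow> 'b) \<Rightarrow> 'b set \<Rightarrow> bool"
  where "is_maximal_order F B D j \<Lambda> \<longleftrightarrow> is_order F B D j \<Lambda> \<and>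
    (\<forall>\<Lambda>'. is_order F B D j \<Lambda>' \<and> \<Lambda> \<subseteq> \<Lambda>' \<longrightarrow> \<Lambda>' = \<Lambda>)"

definition left_ideal :: "'b set \<Rightarrow> ('b, 'n) ring_scheme \<Rightarrow> bool"
  where "left_ideal I R \<longleftrightarrow> additive_subgroup I R \<and>
    (\<forall>a \<in> carrier R. \<forall>x \<in> I. a \<otimes>\<^bsub>R\<^esub> x \<in> I)"

definition maximal_left_ideal :: "'b set \<Rightarrow> ('b, 'n) ring_scheme \<Rightarrow> bool"
  where "maximal_left_ideal I R \<longleftrightarrow> left_ideal I R \<and> I \<noteq> carrier R \<and>
    (\<forall>J. left_ideal J R \<and> I \<subseteq> J \<longrightarrow> J = I \<or> J = carrier R)"

definition jacobson_radical :: "('b, 'n) ring_scheme \<Rightarrow> 'b set"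
  where "jacobson_radical R = carrier R \<inter> \<Inter>{I. maximal_left_ideal I R}"

text \<open>
  The ramification index of a Brauer class \<open>\<alpha>\<close> of \<open>K\<close> at the prime divisor with local ring \<open>R\<close>.
  The division algebra \<open>D\<close> is unique up to isomorphism and has a unique maximal order,
  so the result does not depend on the choices.
\<close>

definition ramification_index ::
    "('a, 'm) ring_scheme \<Rightarrow> 'a brauer \<Rightarrow> 'a set \<Rightarrow> nat"
  where "ramification_index K \<alpha> R = (THE e.
    \<exists>(D, j) \<in> brauer_base_change K (completion K R) (to_completion K R) \<alpha>.
      division_ring D \<and>
      (\<exists>\<Lambda>. is_maximal_order (completion K R) (completed K R R) D j \<Lambda> \<and>
         ideal_power (D\<lparr>carrier := \<Lambda>\<rparr>) (jacobson_radical (D\<lparr>carrier := \<Lambda>\<rparr>)) e =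
         ideal_prod D (j ` completed K R (max_ideal K R)) \<Lambda>))"

definition ramification_divisor ::
    "('a, 'm) ring_scheme \<Rightarrow> 'a set set \<Rightarrow> 'a brauer \<Rightarrow> 'a qdivisor"
  where "ramification_divisor K Y \<alpha> =
    formal_sum K Y (\<lambda>p. 1 - 1 / of_nat (ramification_index K \<alpha> p))"

text \<open>The relations \<open>\<Sigma>\<^sub>1 \<le>\<^sub>Y \<Sigma>\<^sub>2\<close> and \<open>\<Sigma>\<^sub>1 |\<^sub>Y \<Sigma>\<^sub>2\<close>.\<close>

definition ramification_le ::
    "('a, 'm) ring_scheme \<Rightarrow> 'a set set \<Rightarrow> ('b, 'n) ring_scheme \<Rightarrow> ('a \<Rightarrow> 'b) \<Rightarrow>
     ('c, 'o) ring_scheme \<Rightarrow> ('a \<Rightarrow> 'c) \<Rightarrow> bool"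
  where "ramification_le K Y A i B j \<longleftrightarrow>
    ramification_divisor K Y (brauer_class K B j) - ramification_divisor K Y (brauer_class K A i) \<ge> 0"

definition ramification_dvd ::
    "('a, 'm) ring_scheme \<Rightarrow> 'a set set \<Rightarrow> ('b, 'n) ring_scheme \<Rightarrow> ('a \<Rightarrow> 'b) \<Rightarrow>
     ('c, 'o) ring_scheme \<Rightarrow> ('a \<Rightarrow> 'c) \<Rightarrow> bool"
  where "ramification_dvd K Y A i B j \<longleftrightarrow>
    (\<forall>p \<in> prime_divisors K Y.
       ramification_index K (brauer_class K A i) p dvd ramification_index K (brauer_class K B j) p)"

end

theory Submission
  imports Defs
begin

text \<open>An \<open>X\<close>-effective embedding is by definition one whose ramification divisors
  satisfy \<Delta>_2 - \<Delta>_1 >= 0, which is (1). For (2), compare coefficients at a prime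
  divisor: with a, b the two ramification indices, 1 - 1/b = (1 - 1/a) + (1/a - 1/b) and 1/a - 1/b =
  (1/a)(1 - a/b); this is \<open>ramification_coefficient\<close>. For (3), adding
  \<open>K\<^sub>Y\<close> to both sides of (1) gives \<open>K\<^sub>1\<close> \<le>
  \<open>K\<^sub>2\<close>, and Kodaira dimension is monotone in the divisor
  (\<open>kodaira_mono\<close>): a larger divisor has more sections, hence more degree zero
  fractions, hence at least as large a transcendence degree.\<close>

lemma ramification_coefficient:
  fixes a b :: nat
  assumes "a dvd b"
  shows "(1::'a::field_char_0) - 1 / of_nat b =
    (1 - 1 / of_nat a) + 1 / of_nat a * (1 - 1 / (of_nat b / of_nat a))"
proof (cases "a = 0")
  \<comment> \<open>Divisibility enters only through the junk case \<open>1 / 0 = 0\<close>: it forces \<open>b = 0\<close> when \<open>a = 0\<close>.\<close>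
  case True
  then show ?thesis using assms by simp
next
  case False
  \<comment> \<open>Here \<open>1 / (b / a) = a / b\<close>, so the terms \<open>1 / a\<close>
    cancel; if \<open>b = 0\<close>, both quotients by zero are 0 and the sides still agree.\<close>
  then show ?thesis by (simp add: field_simps)
qed

text \<open>A larger divisor allows worse poles: multiplying by \<open>l\<close> and rounding down
  both preserve the order, so the condition on each order only weakens.\<close>

lemma H0_mono:
  assumes "D \<le> E"
  shows "H0 K Y D l \<subseteq> H0 K Y E l"
proof -
  have "val_ord K p f + \<lfloor>of_nat l * E p\<rfloor> \<ge> 0" if "val_ord K p f + \<lfloor>of_nat l * D p\<rfloor> \<ge> 0" for p f
  proof -
    have "\<lfloor>of_nat l * D p\<rfloor> \<le> \<lfloor>of_nat l * E p\<rfloor>"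
      using assms by (intro floor_mono mult_left_mono) (auto simp: le_fun_def)
    with that show ?thesis by linarith
  qed
  then show ?thesis by (auto simp: H0_def)
qed

lemma section_fractions_mono:
  assumes "D \<le> E"
  shows "section_fractions K Y D \<subseteq> section_fractions K Y E"
  using H0_mono[OF assms] unfolding section_fractions_def by blast

text \<open>The supremum for \<open>M\<close> runs over every finite independent set that occurs for
  \<open>L\<close>.\<close>

lemma trdeg_mono:
  assumes "L \<subseteq> M"
  shows "trdeg K k L \<le> trdeg K k M"
  unfolding trdeg_def using assms by (intro Sup_subset_mono) blast

lemma zero_in_H0:
  assumes "ring K"
  shows "\<zero>\<^bsub>K\<^esub> \<in> H0 K Y D l"
  using ring.ring_simprules(2)[OF assms] by (simp add: H0_def)

lemma kodaira_mono:
  assumes "ring K" and "D \<le> E"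
  shows "kodaira K k Y D \<le> kodaira K k Y E"
proof (cases "\<forall>l > 0. H0 K Y D l = {\<zero>\<^bsub>K\<^esub>}")
  case True
  \<comment> \<open>Without nonzero sections the left side is -1, below every value that
    \<open>kodaira\<close> can take.\<close>
  have "(-1::ereal) \<le> ereal_of_enat n" for n
  proof -
    have "(-1::ereal) \<le> 0" by simp
    also have "0 \<le> ereal_of_enat n" by (cases n) simp_all
    finally show ?thesis .
  qed
  with True show ?thesis by (simp add: kodaira_def)
next
  case False
  \<comment> \<open>A nonzero section for \<open>D\<close> is one for \<open>E\<close>. That
    \<open>H0\<close> contains zero rules out that it differs from the zero space by being
    empty.\<close>
  then have "\<not> (\<forall>l > 0. H0 K Y E l = {\<zero>\<^bsub>K\<^esub>})"
    using H0_mono[OF assms(2)] zero_in_H0[OF assms(1)] by blast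
  moreover have "trdeg K k (section_fractions K Y D) \<le> trdeg K k (section_fractions K Y E)"
    by (intro trdeg_mono section_fractions_mono assms)
  ultimately show ?thesis using False by (auto simp add: kodaira_def)
qed

theorem proposition1p12:
  fixes K :: "('a, 'm) ring_scheme"
    and k :: "'a set"
    and Y :: "'a set set"
    and \<Sigma>\<^sub>1 :: "('b, 'n) ring_scheme" and \<iota>\<^sub>1 :: "'a \<Rightarrow> 'b"
    and \<Sigma>\<^sub>2 :: "('c, 'o) ring_scheme" and \<iota>\<^sub>2 :: "'a \<Rightarrow> 'c"
    and \<phi> :: "'b \<Rightarrow> 'c"
    and \<alpha>\<^sub>1 \<alpha>\<^sub>2 :: "'a brauer"
    and \<Delta>\<^sub>1 \<Delta>\<^sub>2 K\<^sub>Y K\<^sub>1 K\<^sub>2 :: "'a qdivisor"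
    and e\<^sub>1 e\<^sub>2 :: "'a set \<Rightarrow> nat"
  assumes "field K"
    and "subfield k K"
    and "algebraically_closed (K\<lparr>carrier := k\<rparr>)"
    and "\<forall>n::nat. n > 0 \<longrightarrow> [n] \<cdot>\<^bsub>K\<^esub> \<one>\<^bsub>K\<^esub> \<noteq> \<zero>\<^bsub>K\<^esub>"
    and "\<exists>S. finite S \<and> S \<subseteq> carrier K \<and> generate_field K (k \<union> S) = carrier K"
    and "normal_proper_model K k Y"
    and "csa K \<Sigma>\<^sub>1 \<iota>\<^sub>1"
    and "csa K \<Sigma>\<^sub>2 \<iota>\<^sub>2"
    and "algebra_embedding K \<Sigma>\<^sub>1 \<iota>\<^sub>1 \<Sigma>\<^sub>2 \<iota>\<^sub>2 \<phi>"
    and "ramification_le K Y \<Sigma>\<^sub>1 \<iota>\<^sub>1 \<Sigma>\<^sub>2 \<iota>\<^sub>2"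
    and "canonical_divisor K k Y K\<^sub>Y"
    and "\<alpha>\<^sub>1 = brauer_class K \<Sigma>\<^sub>1 \<iota>\<^sub>1"
    and "\<alpha>\<^sub>2 = brauer_class K \<Sigma>\<^sub>2 \<iota>\<^sub>2"
    and "\<Delta>\<^sub>1 = ramification_divisor K Y \<alpha>\<^sub>1"
    and "\<Delta>\<^sub>2 = ramification_divisor K Y \<alpha>\<^sub>2"
    and "K\<^sub>1 = K\<^sub>Y + \<Delta>\<^sub>1"
    and "K\<^sub>2 = K\<^sub>Y + \<Delta>\<^sub>2"
    and "e\<^sub>1 = ramification_index K \<alpha>\<^sub>1"
    and "e\<^sub>2 = ramification_index K \<alpha>\<^sub>2"
  shows "\<Delta>\<^sub>1 \<le> \<Delta>\<^sub>2 \<and>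
    (ramification_dvd K Y \<Sigma>\<^sub>1 \<iota>\<^sub>1 \<Sigma>\<^sub>2 \<iota>\<^sub>2 \<longrightarrow>
      K\<^sub>2 = K\<^sub>1 + formal_sum K Y (\<lambda>p.
        1 / of_nat (e\<^sub>1 p) * (1 - 1 / (of_nat (e\<^sub>2 p) / of_nat (e\<^sub>1 p))))) \<and>
    (q_cartier K Y K\<^sub>1 \<and> q_cartier K Y K\<^sub>2 \<and> ramification_le K Y \<Sigma>\<^sub>1 \<iota>\<^sub>1 \<Sigma>\<^sub>2 \<iota>\<^sub>2 \<longrightarrow>
      kodaira K k Y K\<^sub>1 \<le> kodaira K k Y K\<^sub>2)"
proof (intro conjI impI)
  show le: "\<Delta>\<^sub>1 \<le> \<Delta>\<^sub>2"
    using assms(10,12-15) by (simp add: ramification_le_def le_fun_def)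
  show "kodaira K k Y K\<^sub>1 \<le> kodaira K k Y K\<^sub>2"
    using le assms(1,16,17) by (intro kodaira_mono) (simp_all add: field.is_ring le_fun_def)
next
  assume dvd: "ramification_dvd K Y \<Sigma>\<^sub>1 \<iota>\<^sub>1 \<Sigma>\<^sub>2 \<iota>\<^sub>2"
  have "K\<^sub>2 p = (K\<^sub>1 + formal_sum K Y (\<lambda>p.
      1 / of_nat (e\<^sub>1 p) * (1 - 1 / (of_nat (e\<^sub>2 p) / of_nat (e\<^sub>1 p))))) p" for p
  proof (cases "p \<in> prime_divisors K Y")
    case True
    then have "e\<^sub>1 p dvd e\<^sub>2 p"
      using dvd assms(12,13,18,19) by (simp add: ramification_dvd_def)
    from ramification_coefficient[OF this, where 'a = rat] show ?thesis
      using True assms(14-19) by (simp add: ramification_divisor_def formal_sum_def)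
  next
    \<comment> \<open>Off the prime divisors \<Delta>_1, \<Delta>_2 and the formal sum are all 0, so
      both sides equal \<open>K\<^sub>Y p\<close>.\<close>
    case False
    then show ?thesis
      using assms(14-17) by (simp add: ramification_divisor_def formal_sum_def)
  qed
  then show "K\<^sub>2 = K\<^sub>1 + formal_sum K Y (\<lambda>p.
      1 / of_nat (e\<^sub>1 p) * (1 - 1 / (of_nat (e\<^sub>2 p) / of_nat (e\<^sub>1 p))))"
    by blast
qed

end
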